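(* Let $n,s\in\mathbb{N}$ be fixed. There exist a Pfaffian chain $\vec{q}=(q_1,\dots,q_s)$ of order $s$ on $\mathbb{R}^n$ and a constant $c=c(n,s)>0$ such that, for every $\beta\in\mathbb{N}$, there exist $n$ Pfaffian functions $f_1,\dots,f_n:\mathbb{R}^n\to\mathbb{R}$ with respect to $\vec{q}$, each of format $(s,\beta,s)$, having at least $c\,\beta^{n+s}$ regular common zeros in $\mathbb{R}^n$.
   Context: Notation: $\mathbb{N}$ denotes the positive integers, and $\mathbb{R}[Z_1,\dots,Z_r]_{(\le d)}$ denotes the real vector space of polynomials of total degree at most $d$ in $Z_1,\dots,Z_r$. Pfaffian chains. Let $\mathcal{U}\subseteq\mathbb{R}^n$ be open. A Pfaffian chain of order $s\in\mathbb{Z}_{\ge 0}$ and chain-degree $\alpha\in\mathbb{N}$ on $\mathcal{U}$ is a sequence of smooth functions $\vec{q}=(q_1,\dots,q_s)$ on $\mathcal{U}$ such that there exist polynomials $P_{i,j}\in\mathbb{R}[X_1,\dots,X_n,Y_1,\dots,Y_j]_{(\le\alpha)}$ with $$dq_j(\mathbf{x})=\sum_{i=1}^n P_{i,j}(\mathbf{x},q_1(\mathbf{x}),\dots,q_j(\mathbf{x}))\,dx_i\qquad (j=1,\dots,s).$$ Pfaffian functions. Let $\beta\in\mathbb{N}$. A function $f(\mathbf{x})=P(\mathbf{x},q_1(\mathbf{x}),\dots,q_s(\mathbf{x}))$ with $P\in\mathbb{R}[X_1,\dots,X_n,Y_1,\dots,Y_s]_{(\le\beta)}$, where $\vec q$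 is a Pfaffian chain of order $s$ and chain-degree $\alpha$, is called a Pfaffian function with respect to $\vec{q}$ of format $(\alpha,\beta,s)$. Thus format $(s,\beta,s)$ means that the chain $\vec q$ has order $s$ and chain-degree $s$, and that the defining polynomial has total degree at most $\beta$. A common zero $y\in\mathbb{R}^n$ of $f_1,\dots,f_n$ is regular if the Jacobian matrix of $F=(f_1,\dots,f_n)$ at $y$ has nonzero determinant. *)

theory Defs
  imports "HOL-Analysis.Analysis" "HOL-Library.Poly_Mapping"
begin

text \<open>
  Real polynomials in variables of type \<open>'v\<close>: a finitely supported map from monomials to
  coefficients, a monomial being a finitely supported map from variables to exponents.
\<close>

type_synonym 'v mpoly = "('v \<Rightarrow>\<^sub>0 nat) \<Rightarrow>\<^sub>0 real"

definition monom_degree :: "('v \<Rightarrow>\<^sub>0 nat) \<Rightarrow> nat" where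
  "monom_degree m = (\<Sum>v\<in>Poly_Mapping.keys m. Poly_Mapping.lookup m v)"

definition mpoly_vars :: "'v mpoly \<Rightarrow> 'v set" where
  "mpoly_vars P = (\<Union>m\<in>Poly_Mapping.keys P. Poly_Mapping.keys m)"

definition mpoly_eval :: "'v mpoly \<Rightarrow> ('v \<Rightarrow> real) \<Rightarrow> real" where
  "mpoly_eval P a =
     (\<Sum>m\<in>Poly_Mapping.keys P. Poly_Mapping.lookup P m *
        (\<Prod>v\<in>Poly_Mapping.keys m. a v ^ Poly_Mapping.lookup m v))"

text \<open>The space \<open>\<real>[V]\<close> of polynomials in the variables \<open>V\<close> of total degree at most \<open>d\<close>.\<close>

definition polys_le :: "'v set \<Rightarrow> nat \<Rightarrow> 'v mpoly set" where
  "polys_le V d =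
     {P. mpoly_vars P \<subseteq> V \<and> (\<forall>m\<in>Poly_Mapping.keys P. monom_degree m \<le> d)}"

text \<open>
  The variables \<open>X\<^sub>i\<close>, with \<open>i\<close> in the index type \<open>'n\<close> of the ambient space, are \<open>Inl i\<close>;
  the variables \<open>Y\<^sub>k\<close> are \<open>Inr k\<close>, with \<open>k\<close> counted from 1.
\<close>

definition XY_vars :: "nat \<Rightarrow> ('n + nat) set" where
  "XY_vars j = range Inl \<union> Inr ` {1..j}"

text \<open>
  The assignment \<open>X\<^sub>i = x\<^sub>i\<close>, \<open>Y\<^sub>k = q\<^sub>k(x)\<close>. Values of \<open>Y\<^sub>k\<close> with \<open>k > j\<close> do not matter for
  polynomials with variables in \<open>XY_vars j\<close>.
\<close>

definition XY_point :: "(nat \<Rightarrow> real^'n \<Rightarrow> real) \<Rightarrow> real^'n \<Rightarrow> 'n + nat \<Rightarrow> real" where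
  "XY_point q x = case_sum (\<lambda>i. x $ i) (\<lambda>k. q k x)"

text \<open>Continuous differentiability of order \<open>k\<close> and smoothness; meant for open \<open>U\<close> only.\<close>

primrec Ck_on :: "nat \<Rightarrow> 'a::real_normed_vector set \<Rightarrow> ('a \<Rightarrow> real) \<Rightarrow> bool" where
  "Ck_on 0 U f \<longleftrightarrow> continuous_on U f"
| "Ck_on (Suc k) U f \<longleftrightarrow>
     (\<forall>x\<in>U. f differentiable (at x)) \<and>
     (\<forall>v. Ck_on k U (\<lambda>x. frechet_derivative f (at x) v))"

definition smooth_on :: "'a::real_normed_vector set \<Rightarrow> ('a \<Rightarrow> real) \<Rightarrow> bool" where
  "smooth_on U f \<longleftrightarrow> (\<forall>k. Ck_on k U f)"

text \<open>
  Functions on \<open>U\<close> are total functions whose values outside \<open>U\<close> are irrelevant. A chain of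
  order \<open>s\<close> consists of \<open>q 1, ..., q s\<close>; the values of \<open>q\<close> at other indices are irrelevant.
\<close>

definition pfaffian_chain ::
  "(real^'n) set \<Rightarrow> nat \<Rightarrow> nat \<Rightarrow> (nat \<Rightarrow> real^'n \<Rightarrow> real) \<Rightarrow> bool" where
  "pfaffian_chain U s \<alpha> q \<longleftrightarrow>
     open U \<and> \<alpha> \<ge> 1 \<and>
     (\<forall>j\<in>{1..s}. smooth_on U (q j)) \<and>
     (\<exists>P :: 'n \<Rightarrow> nat \<Rightarrow> ('n + nat) mpoly.
        \<forall>j\<in>{1..s}.
          (\<forall>i. P i j \<in> polys_le (XY_vars j) \<alpha>) \<and>
          (\<forall>x\<in>U. (q j has_derivative
             (\<lambda>dx. \<Sum>i\<in>UNIV. mpoly_eval (P i j) (XY_point q x) * dx $ i)) (at x)))"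

text \<open>\<open>f\<close> is a Pfaffian function on \<open>U\<close> with respect to \<open>q\<close> of format \<open>(\<alpha>, \<beta>, s)\<close>.\<close>

definition pfaffian_function ::
  "(real^'n) set \<Rightarrow> (nat \<Rightarrow> real^'n \<Rightarrow> real) \<Rightarrow> nat \<Rightarrow> nat \<Rightarrow> nat \<Rightarrow> (real^'n \<Rightarrow> real) \<Rightarrow> bool" where
  "pfaffian_function U q \<alpha> \<beta> s f \<longleftrightarrow>
     pfaffian_chain U s \<alpha> q \<and> \<beta> \<ge> 1 \<and>
     (\<exists>P \<in> polys_le (XY_vars s) \<beta>. \<forall>x\<in>U. f x = mpoly_eval P (XY_point q x))"

text \<open>
  The differentiability clause only guards against the arbitrary value of the Jacobian at
  points of non-differentiability; Pfaffian functions are differentiable everywhere on \<open>U\<close>.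
\<close>

definition regular_common_zeros :: "('n \<Rightarrow> real^'n \<Rightarrow> real) \<Rightarrow> (real^'n) set" where
  "regular_common_zeros f =
     {y. (\<forall>i. f i y = 0) \<and>
         (\<lambda>x. \<chi> i. f i x) differentiable (at y) \<and>
         det (jacobian (\<lambda>x. \<chi> i. f i x) (at y)) \<noteq> 0}"

end

theory Submission
  imports Defs "HOL-Computational_Algebra.Primes" "HOL-Real_Asymp.Real_Asymp"
begin

text \<open>
  All the transcendence is put into one coordinate. Fix an index \<open>i\<^sub>0\<close> and take the chain
  \<open>q\<^sub>k(x) = exp(\<lambda>\<^sub>k x\<^bsub>i\<^sub>0\<^esub>)\<close>, where \<open>\<lambda>\<^sub>k\<close> is the logarithm of the \<open>k\<close>-th prime,
  counted from 0. Since
  \<open>dq\<^sub>k = \<lambda>\<^sub>k q\<^sub>k dx\<^bsub>i\<^sub>0\<^esub>\<close>, it has chain-degree 1, hence also chain-degree \<open>s\<close>.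

  In the single variable \<open>t = x\<^bsub>i\<^sub>0\<^esub>\<close>, a monomial in \<open>t, q\<^sub>1, \<dots>, q\<^sub>s\<close> is a function
  \<open>t\<^sup>a exp(\<mu>t)\<close>, and by unique factorization distinct monomials have distinct pairs
  \<open>(\<mu>, a)\<close>. Such functions have different growth at infinity, so they are linearly independent
  (\<open>exp_monomials_independent\<close>). There are about \<open>\<beta>\<^bsup>s+1\<^esup>\<close> monomials of degree at most \<open>\<beta>\<close>.

  Given \<open>N\<close> linearly independent functions, linear algebra provides \<open>N\<close> points at which
  arbitrary values can be interpolated. Prescribing alternating signs at these points forces
  \<open>N - 1\<close> zeros by the intermediate value theorem; subtracting a small regular value, which
  exists by Sard's theorem and only changes the coefficient of the constant monomial, makes
  all zeros simple (\<open>combination_with_many_simple_zeros\<close>). This gives a Pfaffian function of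
  \<open>x\<^bsub>i\<^sub>0\<^esub>\<close> alone with at least a constant times \<open>\<beta>\<^bsup>s+1\<^esup>\<close> simple zeros. The same argument without
  exponentials gives, for each other coordinate, a polynomial of degree at most \<open>\<beta>\<close> with at
  least a constant times \<open>\<beta>\<close> simple zeros.

  The system formed by these \<open>n\<close> functions, one for each coordinate, has a diagonal Jacobian,
  so every point of the product of the sets of simple zeros is a regular common zero, and this
  product has at least a constant times \<open>\<beta>\<^bsup>s+1\<^esup> \<beta>\<^bsup>n-1\<^esup> = \<beta>\<^bsup>n+s\<^esup>\<close> points.
\<close>

section \<open>Linear independence of exponential monomials\<close>

text \<open>
  Growth at infinity orders the functions \<open>t\<^sup>a exp(\<mu>t)\<close> lexicographically by \<open>(\<mu>, a)\<close>.
\<close>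

lemma exp_monomial_ratio_tendsto_0:
  fixes \<mu> \<nu> :: real
  assumes "\<mu> < \<nu> \<or> \<mu> = \<nu> \<and> a < b"
  shows "((\<lambda>t. t ^ a * exp (\<mu> * t) / (t ^ b * exp (\<nu> * t))) \<longlongrightarrow> 0) at_top"
proof (cases "\<mu> < \<nu>")
  case True
  then have "\<nu> - \<mu> > 0" by simp
  then have "((\<lambda>t. t powr (real a - real b) * exp (-(\<nu> - \<mu>) * t)) \<longlongrightarrow> 0) at_top"
    by real_asymp
  moreover have "\<forall>\<^sub>F t in at_top. t powr (real a - real b) * exp (-(\<nu> - \<mu>) * t)
      = t ^ a * exp (\<mu> * t) / (t ^ b * exp (\<nu> * t))"
    using eventually_gt_at_top[of 0]
    by eventually_elim (simp add: powr_diff powr_realpow algebra_simps exp_diff)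
  ultimately show ?thesis
    by (rule Lim_transform_eventually)
next
  case False
  with assms have eq: "\<mu> = \<nu>" and "a < b" by auto
  then have "real a - real b < 0" by simp
  then have "((\<lambda>t. t powr (real a - real b)) \<longlongrightarrow> 0) at_top"
    by real_asymp
  moreover have "\<forall>\<^sub>F t in at_top. t powr (real a - real b)
      = t ^ a * exp (\<mu> * t) / (t ^ b * exp (\<nu> * t))"
    using eventually_gt_at_top[of 0]
    by eventually_elim (simp add: powr_diff powr_realpow eq)
  ultimately show ?thesis
    by (rule Lim_transform_eventually)
qed

text \<open>
  Dividing a vanishing combination by its term of fastest growth and letting \<open>t\<close> tend to
  infinity leaves just the coefficient of that term.
\<close>

lemma exp_monomials_independent:
  fixes a :: "'i \<Rightarrow> nat" and \<mu> c :: "'i \<Rightarrow> real"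
  assumes fin: "finite I" and inj: "inj_on (\<lambda>i. (\<mu> i, a i)) I"
    and zero: "\<And>t. (\<Sum>i\<in>I. c i * (t ^ a i * exp (\<mu> i * t))) = 0"
    and k: "k \<in> I"
  shows "c k = 0"
proof (rule ccontr)
  assume "c k \<noteq> 0"
  define J where "J = {i\<in>I. c i \<noteq> 0}"
  have J: "finite J" "J \<noteq> {}" using fin k \<open>c k \<noteq> 0\<close> by (auto simp: J_def)
  define \<nu> where "\<nu> = Max (\<mu> ` J)"
  define L where "L = {i\<in>J. \<mu> i = \<nu>}"
  have "\<nu> \<in> \<mu> ` J" unfolding \<nu>_def using J by (intro Max_in) auto
  then have L: "finite L" "L \<noteq> {}" using J by (auto simp: L_def)
  have "Max (a ` L) \<in> a ` L" using L by (intro Max_in) auto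
  then obtain l where l: "l \<in> L" "a l = Max (a ` L)" by auto
  have lJ: "l \<in> J" "l \<in> I" "\<mu> l = \<nu>" using l by (auto simp: L_def J_def)
  have dom: "\<mu> i < \<mu> l \<or> \<mu> i = \<mu> l \<and> a i < a l" if "i \<in> J" "i \<noteq> l" for i
  proof -
    have "\<mu> i \<le> \<nu>" unfolding \<nu>_def using J that by (intro Max_ge) auto
    moreover have "a i \<le> a l" if "\<mu> i = \<nu>"
      unfolding l(2) using L \<open>i \<in> J\<close> that by (intro Max_ge) (auto simp: L_def)
    moreover have "(\<mu> i, a i) \<noteq> (\<mu> l, a l)"
      using inj lJ that by (auto simp: J_def inj_on_def)
    ultimately show ?thesis using lJ(3) by force
  qed
  let ?g = "\<lambda>i t. c i * (t ^ a i * exp (\<mu> i * t) / (t ^ a l * exp (\<mu> l * t)))"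
  have "((\<lambda>t. ?g i t) \<longlongrightarrow> (if i = l then c l else 0)) at_top" if "i \<in> I" for i
  proof -
    consider "i = l" | "i \<notin> J" | "i \<in> J" "i \<noteq> l" by blast
    then show ?thesis
    proof cases
      case 1
      have "\<forall>\<^sub>F t in at_top. c l = ?g l t"
        using eventually_gt_at_top[of "0::real"] by eventually_elim simp
      then have "((\<lambda>t. ?g l t) \<longlongrightarrow> c l) at_top"
        by (rule Lim_transform_eventually[OF tendsto_const])
      with 1 show ?thesis by simp
    next
      case 2
      with that lJ show ?thesis by (auto simp: J_def)
    next
      case 3
      from tendsto_mult_right_zero[OF exp_monomial_ratio_tendsto_0[OF dom[OF 3]]] 3
      show ?thesis by simp
    qed
  qed
  then have "((\<lambda>t. \<Sum>i\<in>I. ?g i t) \<longlongrightarrow> (\<Sum>i\<in>I. if i = l then c l else 0)) at_top"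
    by (intro tendsto_sum)
  moreover have "(\<Sum>i\<in>I. ?g i t) = 0" for t
  proof -
    have "(\<Sum>i\<in>I. ?g i t)
        = (\<Sum>i\<in>I. c i * (t ^ a i * exp (\<mu> i * t))) / (t ^ a l * exp (\<mu> l * t))"
      by (simp add: sum_divide_distrib)
    with zero show ?thesis by simp
  qed
  ultimately have "((\<lambda>t::real. 0) \<longlongrightarrow> c l) at_top"
    using fin lJ by simp
  then have "c l = 0"
    using tendsto_unique[OF trivial_limit_at_top_linorder _ tendsto_const] by blast
  with lJ show False by (simp add: J_def)
qed

section \<open>Interpolation and simple zeros\<close>

text \<open>
  The points are found one at a time. With enough points for the functions indexed by \<open>I\<close>,
  subtract from a further function \<open>h\<close> its interpolant at these points. The difference is
  not identically zero, by independence, so it is nonzero at some point; that point is new,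
  and the difference is the correction needed to prescribe the value there without disturbing
  the values at the old points.
\<close>

lemma interpolation_points_exist:
  fixes g :: "'i \<Rightarrow> 'a \<Rightarrow> 'f::field"
  assumes "finite I"
    and "\<And>c k. (\<And>t. (\<Sum>i\<in>I. c i * g i t) = 0) \<Longrightarrow> k \<in> I \<Longrightarrow> c k = 0"
  shows "\<exists>T. finite T \<and> card T = card I \<and> (\<forall>y. \<exists>c. \<forall>t\<in>T. (\<Sum>i\<in>I. c i * g i t) = y t)"
  using assms
proof (induction I rule: finite_induct)
  case empty
  show ?case by (intro exI[of _ "{}"]) auto
next
  case (insert h I)
  have upd: "(\<Sum>i\<in>insert h I. (c(h := d)) i * g i t) = d * g h t + (\<Sum>i\<in>I. c i * g i t)"
    for c d t
    using insert.hyps by (auto intro!: sum.cong)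
  have indep: "c k = 0" if "\<And>t. (\<Sum>i\<in>I. c i * g i t) = 0" "k \<in> I" for c k
    using insert.prems[of "c(h := 0)" k] that insert.hyps(2) unfolding upd
    by (auto split: if_splits)
  have "\<exists>T. finite T \<and> card T = card I \<and> (\<forall>y. \<exists>c. \<forall>t\<in>T. (\<Sum>i\<in>I. c i * g i t) = y t)"
    by (rule insert.IH) (rule indep)
  then obtain T where T: "finite T" "card T = card I"
    and interp: "\<And>y. \<exists>c. \<forall>t\<in>T. (\<Sum>i\<in>I. c i * g i t) = y t"
    by blast
  obtain b where b: "\<And>t. t \<in> T \<Longrightarrow> (\<Sum>i\<in>I. b i * g i t) = - g h t"
    using interp[of "\<lambda>t. - g h t"] by blast
  \<comment> \<open>The difference between \<open>g h\<close> and its interpolant, as \<open>b\<close> interpolates \<open>- g h\<close>.\<close>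
  let ?r = "\<lambda>t. g h t + (\<Sum>i\<in>I. b i * g i t)"
  obtain t0 where t0: "?r t0 \<noteq> 0"
    using insert.prems[of "b(h := 1)" h] unfolding upd by auto
  then have "t0 \<notin> T" using b by auto
  have "\<exists>c. \<forall>t\<in>insert t0 T. (\<Sum>i\<in>insert h I. c i * g i t) = y t" for y
  proof -
    obtain c where c: "\<And>t. t \<in> T \<Longrightarrow> (\<Sum>i\<in>I. c i * g i t) = y t"
      using interp[of y] by blast
    define d where "d = (y t0 - (\<Sum>i\<in>I. c i * g i t0)) / ?r t0"
    have "(\<Sum>i\<in>insert h I. ((\<lambda>i. c i + d * b i)(h := d)) i * g i t)
        = d * ?r t + (\<Sum>i\<in>I. c i * g i t)" for t
      unfolding upd by (simp add: algebra_simps sum.distrib sum_distrib_left)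
    moreover have "d * ?r t0 = y t0 - (\<Sum>i\<in>I. c i * g i t0)"
      using t0 by (simp add: d_def)
    ultimately show ?thesis
      using b c by (intro exI[of _ "(\<lambda>i. c i + d * b i)(h := d)"]) auto
  qed
  moreover have "card (insert t0 T) = card (insert h I)"
    using T \<open>t0 \<notin> T\<close> insert.hyps by simp
  ultimately show ?case using T(1) by (intro exI[of _ "insert t0 T"]) auto
qed

text \<open>
  By Sard's theorem the critical values form a null set, which cannot contain an interval.
  The function is transported to \<open>real^1\<close>, where that theorem is stated.
\<close>

lemma critical_values_avoidable:
  fixes f f' :: "real \<Rightarrow> real"
  assumes der: "\<And>t. (f has_real_derivative f' t) (at t)" and "e > 0"
  shows "\<exists>\<epsilon>. \<bar>\<epsilon>\<bar> < e \<and> (\<forall>t. f t = \<epsilon> \<longrightarrow> f' t \<noteq> 0)"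
proof -
  define F :: "real^1 \<Rightarrow> real^1" where "F x = vec (f (x $ 1))" for x
  define S :: "(real^1) set" where "S = {x. f' (x $ 1) = 0}"
  have "negligible (F ` S)"
  proof (rule baby_Sard[where f' = "\<lambda>_ _. 0"])
    fix x :: "real^1" assume "x \<in> S"
    then have f_der: "(f has_derivative (\<lambda>_. 0)) (at (x $ 1))"
      using der[of "x $ 1"] by (simp add: S_def has_field_derivative_def lambda_zero)
    have "((\<lambda>x::real^1. x $ 1) has_derivative (\<lambda>h. h $ 1)) (at x within S)"
      by (rule bounded_linear_imp_has_derivative) (rule bounded_linear_vec_nth)
    from has_derivative_compose[OF this f_der]
    have comp_der: "((\<lambda>x. f (x $ 1)) has_derivative (\<lambda>_. 0)) (at x within S)" .
    have "bounded_linear (vec :: real \<Rightarrow> real^1)"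
      by (rule linear_conv_bounded_linear[THEN iffD1]) (rule linear_vec)
    from bounded_linear.has_derivative[OF this comp_der]
    show "(F has_derivative (\<lambda>_. 0)) (at x within S)"
      unfolding F_def by (simp add: zero_vec_def vec_def)
    show "rank (matrix (\<lambda>_::real^1. 0 :: real^1)) < CARD(1)"
    proof -
      have "matrix (\<lambda>_::real^1. 0 :: real^1) = 0"
        by (simp add: matrix_def vec_eq_iff)
      then show ?thesis by simp
    qed
  qed simp
  then have "\<not> ball (0::real^1) e \<subseteq> F ` S"
    using \<open>e > 0\<close> negligible_subset open_not_negligible[of "ball (0::real^1) e"] by auto
  then obtain y where "y \<in> ball 0 e" and y_notin: "y \<notin> F ` S" by blast
  then have norm_y: "norm y < e" by simp
  have "f' t \<noteq> 0" if "f t = y $ 1" for t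
  proof
    assume "f' t = 0"
    then have "vec t \<in> S" by (simp add: S_def)
    moreover have "F (vec t) = y" using that by (simp add: F_def vec_eq_iff)
    ultimately show False using y_notin by blast
  qed
  moreover have "\<bar>y $ 1\<bar> < e" using norm_y component_le_norm_cart[of y 1] by linarith
  ultimately show ?thesis by blast
qed

lemma zeros_of_alternating_function:
  fixes f :: "real \<Rightarrow> real"
  assumes cont: "\<And>t. isCont f t"
    and mono: "\<And>i j. i < j \<Longrightarrow> j < N \<Longrightarrow> x i < x j"
    and sgn: "\<And>k. k < N \<Longrightarrow> f (x k) * (- 1) ^ k > 0"
  shows "\<exists>Z. finite Z \<and> card Z = N - 1 \<and> (\<forall>z\<in>Z. f z = 0)"
proof -
  have "\<exists>z. x k < z \<and> z < x (Suc k) \<and> f z = 0" if "k < N - 1" for k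
  proof -
    have lt: "x k < x (Suc k)" using mono that by simp
    have 1: "f (x k) * (- 1) ^ k > 0" "f (x (Suc k)) * (- 1) ^ k < 0"
      using sgn[of k] sgn[of "Suc k"] that by auto
    obtain z where z: "x k \<le> z" "z \<le> x (Suc k)" "- (f z * (- 1) ^ k) = 0"
      using IVT[of "\<lambda>t. - (f t * (- 1) ^ k)" "x k" 0 "x (Suc k)"] 1 lt cont
      by (auto intro!: continuous_intros)
    then have "f z = 0" by simp
    moreover have "z \<noteq> x k" "z \<noteq> x (Suc k)" using 1 \<open>f z = 0\<close> by auto
    ultimately show ?thesis using z by force
  qed
  then obtain z where z: "\<And>k. k < N - 1 \<Longrightarrow> x k < z k \<and> z k < x (Suc k) \<and> f (z k) = 0"
    by metis
  have less: "z i < z j" if "i < j" "j < N - 1" for i j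
  proof -
    from that consider "Suc i = j" | "Suc i < j" "j < N" by linarith
    then have "x (Suc i) \<le> x j" using mono[of "Suc i" j] by cases simp_all
    then show ?thesis using z[of i] z[of j] that by fastforce
  qed
  then have "inj_on z {..<N - 1}"
    unfolding inj_on_def by (metis lessThan_iff less_irrefl linorder_neqE_nat)
  then show ?thesis
    using z by (intro exI[of _ "z ` {..<N - 1}"]) (auto simp: card_image)
qed

lemma increasing_enumeration:
  fixes T :: "real set"
  assumes "finite T"
  shows "\<exists>x. (\<forall>i j. i < j \<longrightarrow> j < card T \<longrightarrow> x i < x j) \<and> x ` {..<card T} = T"
proof (intro exI[of _ "\<lambda>k. sorted_list_of_set T ! k"] conjI allI impI)
  let ?l = "sorted_list_of_set T"
  have len: "length ?l = card T" by simp
  fix i j assume "i < j" "j < card T"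
  then show "?l ! i < ?l ! j"
    using strict_sorted_list_of_set[of T] len by (metis sorted_wrt_nth_less)
next
  show "(\<lambda>k. sorted_list_of_set T ! k) ` {..<card T} = T"
    using assms nth_image[of "card T" "sorted_list_of_set T"]
    by (simp add: lessThan_atLeast0)
qed

text \<open>
  Interpolating the values \<open>1, -1, 1, \<dots>\<close> gives a combination that still alternates in sign
  after any constant \<open>\<epsilon>\<close> with \<open>\<bar>\<epsilon>\<bar> < 1\<close> is subtracted; if \<open>\<epsilon>\<close> is a regular value, all zeros
  after the subtraction are simple. The constant function \<open>g k0\<close> is in the family in order that
  the shifted function be again a combination.
\<close>

lemma combination_with_many_simple_zeros:
  fixes g g' :: "'i \<Rightarrow> real \<Rightarrow> real"
  assumes fin: "finite I"
    and indep: "\<And>c k. (\<And>t. (\<Sum>i\<in>I. c i * g i t) = 0) \<Longrightarrow> k \<in> I \<Longrightarrow> c k = 0"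
    and der: "\<And>i t. i \<in> I \<Longrightarrow> (g i has_real_derivative g' i t) (at t)"
    and one: "k0 \<in> I" "\<And>t. g k0 t = 1"
  shows "\<exists>c Z. finite Z \<and> card Z = card I - 1 \<and>
    (\<forall>z\<in>Z. (\<Sum>i\<in>I. c i * g i z) = 0 \<and> (\<Sum>i\<in>I. c i * g' i z) \<noteq> 0)"
proof -
  have "\<exists>T. finite T \<and> card T = card I \<and> (\<forall>y. \<exists>c. \<forall>t\<in>T. (\<Sum>i\<in>I. c i * g i t) = y t)"
    by (rule interpolation_points_exist[OF fin]) (rule indep)
  then obtain T where T: "finite T" "card T = card I"
    and interp: "\<And>y. \<exists>c. \<forall>t\<in>T. (\<Sum>i\<in>I. c i * g i t) = y t"
    by blast
  obtain x where mono: "\<And>i j. i < j \<Longrightarrow> j < card I \<Longrightarrow> x i < x j" and xT: "x ` {..<card I} = T"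
    using increasing_enumeration[OF T(1)] T(2) by metis
  have inj: "inj_on x {..<card I}"
    unfolding inj_on_def by (metis lessThan_iff less_irrefl linorder_neqE_nat mono)
  obtain c where c: "\<And>t. t \<in> T \<Longrightarrow> (\<Sum>i\<in>I. c i * g i t) = (- 1) ^ inv_into {..<card I} x t"
    using interp[of "\<lambda>t. (- 1) ^ inv_into {..<card I} x t"] by blast
  define f where "f t = (\<Sum>i\<in>I. c i * g i t)" for t
  define f' where "f' t = (\<Sum>i\<in>I. c i * g' i t)" for t
  have f_x: "f (x k) = (- 1) ^ k" if "k < card I" for k
    using that c xT inv_into_f_f[OF inj] by (auto simp: f_def)
  have f_der: "(f has_real_derivative f' t) (at t)" for t
    unfolding f_def f'_def using der by (auto intro!: DERIV_sum DERIV_cmult)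
  obtain \<epsilon> where \<epsilon>: "\<bar>\<epsilon>\<bar> < 1" "\<And>t. f t = \<epsilon> \<Longrightarrow> f' t \<noteq> 0"
    using critical_values_avoidable[OF f_der, of 1] by auto
  have "(f (x k) - \<epsilon>) * (- 1) ^ k > 0" if "k < card I" for k
    using \<epsilon>(1) f_x[OF that] by (cases "even k") (auto simp: abs_less_iff)
  moreover have "isCont (\<lambda>t. f t - \<epsilon>) t" for t
    using DERIV_isCont[OF f_der] by (intro continuous_intros)
  ultimately obtain Z where Z: "finite Z" "card Z = card I - 1" "\<And>z. z \<in> Z \<Longrightarrow> f z - \<epsilon> = 0"
    using zeros_of_alternating_function[where f = "\<lambda>t. f t - \<epsilon>" and N = "card I" and x = x] mono
    by blast
  define d where "d = c(k0 := c k0 - \<epsilon>)"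
  have d_sum: "(\<Sum>i\<in>I. d i * h i) = (\<Sum>i\<in>I. c i * h i) - \<epsilon> * h k0" for h :: "'i \<Rightarrow> real"
    using fin one(1) by (simp add: d_def sum.remove[of I k0] algebra_simps)
  have "(g k0 has_real_derivative 0) (at t)" for t
    using one(2) by (metis (no_types, lifting) DERIV_const ext)
  then have "g' k0 t = 0" for t
    using der[OF one(1)] DERIV_unique by blast
  then have "(\<Sum>i\<in>I. d i * g i z) = 0 \<and> (\<Sum>i\<in>I. d i * g' i z) \<noteq> 0" if "z \<in> Z" for z
    unfolding d_sum one(2) using Z(3)[OF that] \<epsilon>(2)[of z] by (simp add: f_def f'_def)
  with Z show ?thesis by blast
qed

section \<open>Polynomials with prescribed monomials\<close>

definition monoms_le :: "'v set \<Rightarrow> nat \<Rightarrow> ('v \<Rightarrow>\<^sub>0 nat) set" where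
  "monoms_le V d = {m. Poly_Mapping.keys m \<subseteq> V \<and> monom_degree m \<le> d}"

definition monom_eval :: "('v \<Rightarrow>\<^sub>0 nat) \<Rightarrow> ('v \<Rightarrow> real) \<Rightarrow> real" where
  "monom_eval m a = (\<Prod>v\<in>Poly_Mapping.keys m. a v ^ Poly_Mapping.lookup m v)"

lemma lookup_outside_keys:
  "v \<notin> Poly_Mapping.keys m \<Longrightarrow> Poly_Mapping.lookup m v = 0"
  using not_in_keys_iff_lookup_eq_zero by metis

lemma monom_degree_superset:
  assumes "finite V" "Poly_Mapping.keys m \<subseteq> V"
  shows "monom_degree m = (\<Sum>v\<in>V. Poly_Mapping.lookup m v)"
  unfolding monom_degree_def
proof (rule sum.mono_neutral_left[OF assms], rule ballI)
  fix v assume "v \<in> V - Poly_Mapping.keys m"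
  then show "Poly_Mapping.lookup m v = 0" by (simp add: lookup_outside_keys)
qed

lemma monom_eval_superset:
  assumes "finite V" "Poly_Mapping.keys m \<subseteq> V"
  shows "monom_eval m a = (\<Prod>v\<in>V. a v ^ Poly_Mapping.lookup m v)"
  unfolding monom_eval_def
proof (rule prod.mono_neutral_left[OF assms], rule ballI)
  fix v assume "v \<in> V - Poly_Mapping.keys m"
  then have "Poly_Mapping.lookup m v = 0" by (simp add: lookup_outside_keys)
  then show "a v ^ Poly_Mapping.lookup m v = 1" by simp
qed

lemma mpoly_eval_superset:
  assumes "finite E" "Poly_Mapping.keys P \<subseteq> E"
  shows "mpoly_eval P a = (\<Sum>m\<in>E. Poly_Mapping.lookup P m * monom_eval m a)"
  unfolding mpoly_eval_def monom_eval_def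
proof (rule sum.mono_neutral_left[OF assms], rule ballI)
  fix m assume "m \<in> E - Poly_Mapping.keys P"
  then have "Poly_Mapping.lookup P m = 0" by (simp add: lookup_outside_keys)
  then show "Poly_Mapping.lookup P m
      * (\<Prod>v\<in>Poly_Mapping.keys m. a v ^ Poly_Mapping.lookup m v) = 0" by simp
qed

lemma mpoly_eval_cong:
  assumes "P \<in> polys_le V d" "\<And>v. v \<in> V \<Longrightarrow> a v = b v"
  shows "mpoly_eval P a = mpoly_eval P b"
proof -
  have "a v = b v" if "m \<in> Poly_Mapping.keys P" "v \<in> Poly_Mapping.keys m" for m v
    using assms that by (auto simp: polys_le_def mpoly_vars_def)
  then show ?thesis
    unfolding mpoly_eval_def by (intro sum.cong prod.cong arg_cong2[where f = "(*)"]) auto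
qed

lemma polys_le_mono:
  assumes "P \<in> polys_le V d" "V \<subseteq> W" "d \<le> e"
  shows "P \<in> polys_le W e"
proof -
  have "mpoly_vars P \<subseteq> W" using assms(1,2) unfolding polys_le_def by blast
  moreover have "monom_degree m \<le> e" if "m \<in> Poly_Mapping.keys P" for m
    using assms(1,3) that unfolding polys_le_def by fastforce
  ultimately show ?thesis unfolding polys_le_def by blast
qed

text \<open>
  Used both for coefficients, to build polynomials, and for exponents, to build monomials.
\<close>

lemma lookup_with_support:
  assumes "finite V"
  shows "\<exists>m. Poly_Mapping.keys m \<subseteq> V \<and> (\<forall>v\<in>V. Poly_Mapping.lookup m v = e v)"
proof -
  let ?f = "\<lambda>v. if v \<in> V then e v else 0"
  have "finite {v. ?f v \<noteq> 0}"
    by (rule finite_subset[OF _ assms]) auto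
  then have "Poly_Mapping.lookup (Poly_Mapping.Abs_poly_mapping ?f) = ?f"
    by (rule lookup_Abs_poly_mapping)
  then show ?thesis
    by (intro exI[of _ "Poly_Mapping.Abs_poly_mapping ?f"]) (auto simp: in_keys_iff split: if_splits)
qed

lemma finite_monoms_le:
  assumes "finite V"
  shows "finite (monoms_le V d)"
proof -
  let ?r = "\<lambda>m. restrict (Poly_Mapping.lookup m) V"
  have "?r m \<in> V \<rightarrow>\<^sub>E {..d}" if "m \<in> monoms_le V d" for m
  proof -
    have "Poly_Mapping.lookup m v \<le> d" if "v \<in> V" for v
      using \<open>m \<in> monoms_le V d\<close> member_le_sum[OF that, of "Poly_Mapping.lookup m"] assms
        monom_degree_superset[OF assms, of m]
      by (fastforce simp: monoms_le_def)
    then show ?thesis by auto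
  qed
  moreover have "inj_on ?r (monoms_le V d)"
  proof (rule inj_onI, rule poly_mapping_eqI)
    fix m m' v
    assume *: "m \<in> monoms_le V d" "m' \<in> monoms_le V d" "?r m = ?r m'"
    show "Poly_Mapping.lookup m v = Poly_Mapping.lookup m' v"
    proof (cases "v \<in> V")
      case True
      with fun_cong[OF *(3), of v] show ?thesis by simp
    next
      case False
      with *(1,2) have "v \<notin> Poly_Mapping.keys m" "v \<notin> Poly_Mapping.keys m'"
        by (auto simp: monoms_le_def)
      then show ?thesis by (simp add: in_keys_iff)
    qed
  qed
  moreover have "finite (V \<rightarrow>\<^sub>E {..d})"
    using assms by (intro finite_PiE) auto
  ultimately show ?thesis
    by (meson finite_imageD finite_subset image_subsetI)
qed

text \<open>
  Exponents that are all at most \<open>\<lfloor>d / |V|\<rfloor>\<close> have sum at most \<open>d\<close>, and already this cube of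
  exponent vectors has the order of growth that is needed.
\<close>

lemma card_monoms_le:
  assumes fin: "finite V" and "V \<noteq> {}"
  shows "(real d / real (card V)) ^ card V \<le> real (card (monoms_le V d))"
proof -
  define k where "k = d div card V"
  have pos: "card V > 0" using assms by (simp add: card_gt_0_iff)
  have "\<forall>e. \<exists>m. Poly_Mapping.keys m \<subseteq> V \<and> (\<forall>v\<in>V. Poly_Mapping.lookup m v = e v)"
    using lookup_with_support[OF fin] by blast
  then obtain M :: "('a \<Rightarrow> nat) \<Rightarrow> ('a \<Rightarrow>\<^sub>0 nat)"
    where M: "\<And>e. Poly_Mapping.keys (M e) \<subseteq> V"
      "\<And>e v. v \<in> V \<Longrightarrow> Poly_Mapping.lookup (M e) v = e v"
    by metis
  have "M e \<in> monoms_le V d" if "e \<in> V \<rightarrow>\<^sub>E {..k}" for e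
  proof -
    have "monom_degree (M e) = (\<Sum>v\<in>V. e v)"
      using monom_degree_superset[OF fin M(1)] M(2) by simp
    also have "\<dots> \<le> (\<Sum>v\<in>V. k)" using that by (intro sum_mono) auto
    also have "\<dots> \<le> d" by (simp add: k_def mult.commute)
    finally show ?thesis using M(1) by (simp add: monoms_le_def)
  qed
  moreover have "inj_on M (V \<rightarrow>\<^sub>E {..k})"
    by (rule inj_onI, rule PiE_ext) (auto, metis M(2))
  ultimately have "card (V \<rightarrow>\<^sub>E {..k}) \<le> card (monoms_le V d)"
    using finite_monoms_le[OF fin] by (intro card_inj_on_le[of M]) auto
  moreover have "card (V \<rightarrow>\<^sub>E {..k}) = (k + 1) ^ card V"
    using fin by (simp add: card_funcsetE)
  moreover have "d \<le> (k + 1) * card V"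
    unfolding k_def using dividend_less_times_div[OF pos, of d] by (simp add: mult.commute)
  then have "real d \<le> real ((k + 1) * card V)"
    by (simp only: of_nat_le_iff)
  then have "real d / real (card V) \<le> real (k + 1)"
    using pos by (simp add: divide_le_eq algebra_simps)
  then have "(real d / real (card V)) ^ card V \<le> real (k + 1) ^ card V"
    by (rule power_mono) simp
  ultimately show ?thesis
    by (metis of_nat_le_iff of_nat_power order_trans)
qed

text \<open>
  With \<open>N \<ge> 2\<close> monomials, \<open>N - 1 \<ge> N / 2\<close>, so losing one zero costs only a constant factor even
  for small degrees.
\<close>

lemma card_monoms_le_ge_2:
  assumes "finite V" "v \<in> V" "d \<ge> 1"
  shows "card (monoms_le V d) \<ge> 2"
proof -
  have "{0, Poly_Mapping.single v 1} \<subseteq> monoms_le V d"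
    using assms by (auto simp: monoms_le_def monom_degree_def)
  moreover have "card {0, Poly_Mapping.single v (1::nat)} = 2"
    by (metis card_2_iff lookup_single_eq lookup_zero zero_neq_one)
  ultimately show ?thesis
    using card_mono[OF finite_monoms_le[OF assms(1)]] by metis
qed

section \<open>Exponential polynomials with many simple zeros\<close>

text \<open>
  The rates of the exponentials have to be linearly independent over the rationals; logarithms
  of distinct primes are so by unique factorization.
\<close>

definition log_prime :: "nat \<Rightarrow> real" where
  "log_prime j = ln (real (enumerate {p. prime p} j))"

text \<open>
  Composing a polynomial in \<open>X\<^sub>i\<close> and the \<open>Y\<^sub>k\<close> with this assignment gives a function of one real
  variable. All \<open>X\<^sub>j\<close> get the value \<open>t\<close>, but only one of them occurs in \<open>curve_vars i r\<close>.
\<close>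

definition exp_curve :: "real \<Rightarrow> 'n + nat \<Rightarrow> real" where
  "exp_curve t = case_sum (\<lambda>_. t) (\<lambda>k. exp (log_prime k * t))"

definition curve_vars :: "'n \<Rightarrow> nat \<Rightarrow> ('n + nat) set" where
  "curve_vars i r = insert (Inl i) (Inr ` {1..r})"

lemma finite_curve_vars: "finite (curve_vars i r)"
  unfolding curve_vars_def by blast

lemma card_curve_vars: "card (curve_vars i r) = r + 1"
proof -
  have "Inl i \<notin> Inr ` {1..r}" by blast
  then show ?thesis by (simp add: curve_vars_def card_image)
qed

text \<open>
  Exponentiating turns the two sums into products of prime powers, whose exponents are
  multiplicities.
\<close>

lemma log_prime_combination_inject:
  fixes e e' :: "nat \<Rightarrow> nat"
  assumes fin: "finite J"
    and eq: "(\<Sum>j\<in>J. real (e j) * log_prime j) = (\<Sum>j\<in>J. real (e' j) * log_prime j)"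
    and j: "j \<in> J"
  shows "e j = e' j"
proof -
  define p where "p = enumerate {p::nat. prime p}"
  have prime: "prime (p k)" for k
    using enumerate_in_set[OF primes_infinite] by (simp add: p_def)
  have inj: "inj p"
    unfolding p_def by (rule strict_mono_imp_inj_on[OF strict_mono_enumerate[OF primes_infinite]])
  have exp_eq: "exp (\<Sum>j\<in>J. real (f j) * log_prime j) = real (\<Prod>j\<in>J. p j ^ f j)"
    for f :: "nat \<Rightarrow> nat"
  proof -
    have "exp (real (f j) * log_prime j) = real (p j ^ f j)" for j
      using prime_gt_0_nat[OF prime[of j]]
      by (simp add: log_prime_def p_def[symmetric] exp_of_nat_mult)
    then show ?thesis by (simp add: exp_sum[OF fin])
  qed
  have mult: "multiplicity (p j) (\<Prod>j\<in>J. p j ^ f j) = f j" for f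
  proof -
    have "(\<Prod>j\<in>J. p j ^ f j) = (\<Prod>x\<in>p ` J. x ^ f (inv p x))"
      using inj by (subst prod.reindex) (auto intro: inj_on_subset)
    then show ?thesis
      using multiplicity_prod_prime_powers[of "p ` J" "p j" "\<lambda>x. f (inv p x)"] fin j prime inj
      by auto
  qed
  have "real (\<Prod>j\<in>J. p j ^ e j) = real (\<Prod>j\<in>J. p j ^ e' j)"
    using eq by (metis exp_eq)
  then show ?thesis
    using mult[of e] mult[of e'] by (simp only: of_nat_eq_iff)
qed

lemma monom_eval_exp_curve:
  assumes "Poly_Mapping.keys m \<subseteq> curve_vars i r"
  shows "monom_eval m (exp_curve t) = t ^ Poly_Mapping.lookup m (Inl i) *
    exp ((\<Sum>j\<in>{1..r}. real (Poly_Mapping.lookup m (Inr j)) * log_prime j) * t)"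
proof -
  have "monom_eval m (exp_curve t)
      = t ^ Poly_Mapping.lookup m (Inl i)
        * (\<Prod>j\<in>{1..r}. exp (log_prime j * t) ^ Poly_Mapping.lookup m (Inr j))"
    using monom_eval_superset[OF finite_curve_vars assms]
    by (simp add: curve_vars_def image_iff prod.reindex exp_curve_def)
  also have "(\<Prod>j\<in>{1..r}. exp (log_prime j * t) ^ Poly_Mapping.lookup m (Inr j))
      = exp ((\<Sum>j\<in>{1..r}. real (Poly_Mapping.lookup m (Inr j)) * log_prime j) * t)"
    by (simp add: sum_distrib_right exp_sum mult.assoc exp_of_nat_mult)
  finally show ?thesis .
qed

lemma monoms_independent_on_exp_curve:
  assumes zero: "\<And>t. (\<Sum>m\<in>monoms_le (curve_vars i r) d. c m * monom_eval m (exp_curve t)) = 0"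
    and k: "k \<in> monoms_le (curve_vars i r) d"
  shows "c k = 0"
proof -
  let ?I = "monoms_le (curve_vars i r) d"
  let ?a = "\<lambda>m. Poly_Mapping.lookup m (Inl i)"
  let ?\<mu> = "\<lambda>m. \<Sum>j\<in>{1..r}. real (Poly_Mapping.lookup m (Inr j)) * log_prime j"
  have keys: "Poly_Mapping.keys m \<subseteq> curve_vars i r" if "m \<in> ?I" for m
    using that by (simp add: monoms_le_def)
  have "inj_on (\<lambda>m. (?\<mu> m, ?a m)) ?I"
  proof (rule inj_onI, rule poly_mapping_eqI)
    fix m m' v
    assume *: "m \<in> ?I" "m' \<in> ?I" and eq: "(?\<mu> m, ?a m) = (?\<mu> m', ?a m')"
    have "Poly_Mapping.lookup m (Inr j) = Poly_Mapping.lookup m' (Inr j)" if "j \<in> {1..r}" for j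
      using log_prime_combination_inject[of "{1..r}" "\<lambda>j. Poly_Mapping.lookup m (Inr j)"
          "\<lambda>j. Poly_Mapping.lookup m' (Inr j)" j] eq that by simp
    moreover have "?a m = ?a m'" using eq by simp
    ultimately have inside: "Poly_Mapping.lookup m v = Poly_Mapping.lookup m' v"
      if "v \<in> curve_vars i r"
      using that unfolding curve_vars_def by blast
    have "Poly_Mapping.lookup m v = Poly_Mapping.lookup m' v" if "v \<notin> curve_vars i r"
      using that keys[OF *(1)] keys[OF *(2)] lookup_outside_keys by (metis subsetD)
    with inside show "Poly_Mapping.lookup m v = Poly_Mapping.lookup m' v" by blast
  qed
  moreover have "(\<Sum>m\<in>?I. c m * (t ^ ?a m * exp (?\<mu> m * t))) = 0" for t
  proof -
    have "(\<Sum>m\<in>?I. c m * (t ^ ?a m * exp (?\<mu> m * t)))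
        = (\<Sum>m\<in>?I. c m * monom_eval m (exp_curve t))"
      by (intro sum.cong refl) (simp only: monom_eval_exp_curve[OF keys])
    with zero show ?thesis by simp
  qed
  ultimately show ?thesis
    using k by (rule exp_monomials_independent[OF finite_monoms_le[OF finite_curve_vars]])
qed

text \<open>
  The one-dimensional core of the construction. The number \<open>r\<close> of exponentials is kept variable
  because the coordinate carrying the chain uses \<open>r = s\<close> and all others use \<open>r = 0\<close>.
\<close>

lemma exp_polynomial_with_many_simple_zeros:
  fixes i :: 'n
  assumes d: "d \<ge> 1"
  shows "\<exists>P \<in> polys_le (curve_vars i r) d. \<exists>Z. finite Z \<and>
    real (card Z) \<ge> (real d / real (r + 1)) ^ (r + 1) / 2 \<and>
    (\<forall>z\<in>Z. mpoly_eval P (exp_curve z) = 0 \<and>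
      (\<exists>D. D \<noteq> 0 \<and> ((\<lambda>t. mpoly_eval P (exp_curve t)) has_real_derivative D) (at z)))"
proof -
  define I where "I = monoms_le (curve_vars i r) d"
  define a where "a m = Poly_Mapping.lookup m (Inl i)" for m :: "'n + nat \<Rightarrow>\<^sub>0 nat"
  define \<mu> where "\<mu> m = (\<Sum>j\<in>{1..r}. real (Poly_Mapping.lookup m (Inr j)) * log_prime j)"
    for m :: "'n + nat \<Rightarrow>\<^sub>0 nat"
  define g' where "g' m t = real (a m) * t ^ (a m - 1) * exp (\<mu> m * t)
      + t ^ a m * (\<mu> m * exp (\<mu> m * t))" for m t
  have fin: "finite I" unfolding I_def by (rule finite_monoms_le[OF finite_curve_vars])
  have g: "monom_eval m (exp_curve t) = t ^ a m * exp (\<mu> m * t)" if "m \<in> I" for m t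
    using that monom_eval_exp_curve[of m i r t] by (simp add: I_def monoms_le_def a_def \<mu>_def)
  have der: "((\<lambda>t. monom_eval m (exp_curve t)) has_real_derivative g' m t) (at t)"
    if "m \<in> I" for m t
    unfolding g[OF that] g'_def by (auto intro!: derivative_eq_intros)
  have indep: "c k = 0" if "\<And>t. (\<Sum>m\<in>I. c m * monom_eval m (exp_curve t)) = 0" "k \<in> I" for c k
    using monoms_independent_on_exp_curve[where c = c and k = k] that unfolding I_def by blast
  have "\<exists>c Z. finite Z \<and> card Z = card I - 1 \<and>
    (\<forall>z\<in>Z. (\<Sum>m\<in>I. c m * monom_eval m (exp_curve z)) = 0 \<and> (\<Sum>m\<in>I. c m * g' m z) \<noteq> 0)"
  proof (rule combination_with_many_simple_zeros[OF fin, where ?k0.0 = 0])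
    show "c k = 0" if "\<And>t. (\<Sum>m\<in>I. c m * monom_eval m (exp_curve t)) = 0" "k \<in> I" for c k
      using that by (rule indep)
    show "0 \<in> I" by (simp add: I_def monoms_le_def monom_degree_def)
    show "monom_eval 0 (exp_curve t) = 1" for t by (simp add: monom_eval_def)
  qed (rule der)
  then obtain c Z where Z: "finite Z" "card Z = card I - 1"
    and zeros: "\<And>z. z \<in> Z \<Longrightarrow> (\<Sum>m\<in>I. c m * monom_eval m (exp_curve z)) = 0"
      "\<And>z. z \<in> Z \<Longrightarrow> (\<Sum>m\<in>I. c m * g' m z) \<noteq> 0"
    by blast
  obtain P where P: "Poly_Mapping.keys P \<subseteq> I" "\<And>m. m \<in> I \<Longrightarrow> Poly_Mapping.lookup P m = c m"
    using lookup_with_support[OF fin, of c] by blast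
  have eval: "mpoly_eval P (exp_curve t) = (\<Sum>m\<in>I. c m * monom_eval m (exp_curve t))" for t
    using mpoly_eval_superset[OF fin P(1)] P(2) by simp
  have "((\<lambda>t. mpoly_eval P (exp_curve t)) has_real_derivative (\<Sum>m\<in>I. c m * g' m z)) (at z)" for z
    unfolding eval by (intro DERIV_sum DERIV_cmult der)
  moreover have "P \<in> polys_le (curve_vars i r) d"
    using P(1) by (auto simp: polys_le_def mpoly_vars_def I_def monoms_le_def)
  moreover have "real (card Z) \<ge> (real d / real (r + 1)) ^ (r + 1) / 2"
  proof -
    have "(real d / real (r + 1)) ^ (r + 1) \<le> real (card I)"
      using card_monoms_le[OF finite_curve_vars[of i r], of d] card_curve_vars[of i r]
      by (simp add: I_def curve_vars_def)
    moreover have "card I \<ge> 2"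
      unfolding I_def using d
      by (intro card_monoms_le_ge_2[OF finite_curve_vars, of "Inl i"]) (simp_all add: curve_vars_def)
    ultimately show ?thesis using Z(2) by linarith
  qed
  ultimately show ?thesis using Z(1) zeros eval by metis
qed

section \<open>The chain\<close>

text \<open>
  The factor \<open>c\<close> makes the family closed under directional derivatives, so that induction on
  the order of differentiability goes through.
\<close>

lemma Ck_on_exp_component:
  fixes i :: "'n::finite"
  shows "Ck_on k UNIV (\<lambda>x::real^'n. c * exp (l * x $ i))"
proof (induction k arbitrary: c)
  case 0
  show ?case by (auto intro!: continuous_intros)
next
  case (Suc k)
  have der: "((\<lambda>x::real^'n. c * exp (l * x $ i)) has_derivative
      (\<lambda>v. (c * l * v $ i) * exp (l * x $ i))) (at x)" for x
    by (auto intro!: derivative_eq_intros bounded_linear.has_derivative[OF bounded_linear_vec_nth]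
        simp: algebra_simps)
  then have "frechet_derivative (\<lambda>x::real^'n. c * exp (l * x $ i)) (at x)
      = (\<lambda>v. (c * l * v $ i) * exp (l * x $ i))" for x
    by (metis frechet_derivative_at)
  moreover have "(\<lambda>x::real^'n. c * exp (l * x $ i)) differentiable (at x)" for x
    using der differentiableI by blast
  ultimately show ?case using Suc by simp
qed

lemma pfaffian_chain_exp_component:
  fixes i :: "'n::finite"
  assumes "s \<ge> 1"
  shows "pfaffian_chain UNIV s s (\<lambda>k (x::real^'n). exp (log_prime k * x $ i))"
proof -
  let ?q = "\<lambda>k (x::real^'n). exp (log_prime k * x $ i)"
  define P :: "'n \<Rightarrow> nat \<Rightarrow> ('n + nat) mpoly" where
    "P i' j = (if i' = i then Poly_Mapping.single (Poly_Mapping.single (Inr j) 1) (log_prime j) else 0)"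
    for i' j
  have "smooth_on UNIV (?q j)" for j
    using Ck_on_exp_component[of _ 1 "log_prime j" i] by (simp add: smooth_on_def)
  moreover have "P i' j \<in> polys_le (XY_vars j) s" if "j \<in> {1..s}" for i' j
    using assms that
    by (auto simp: P_def polys_le_def mpoly_vars_def XY_vars_def monom_degree_def)
  moreover have "(?q j has_derivative
      (\<lambda>dx. \<Sum>i'\<in>UNIV. mpoly_eval (P i' j) (XY_point ?q x) * dx $ i')) (at x)" for j x
  proof -
    have "mpoly_eval (P i' j) (XY_point ?q x) * dx $ i'
        = (if i' = i then log_prime j * ?q j x * dx $ i' else 0)" for i' and dx :: "real^'n"
      by (simp add: P_def mpoly_eval_def XY_point_def)
    then have "(\<Sum>i'\<in>UNIV. mpoly_eval (P i' j) (XY_point ?q x) * dx $ i')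
        = log_prime j * ?q j x * dx $ i" for dx :: "real^'n"
      by simp
    moreover have "(?q j has_derivative (\<lambda>dx. log_prime j * ?q j x * dx $ i)) (at x)"
      by (auto intro!: derivative_eq_intros bounded_linear.has_derivative[OF bounded_linear_vec_nth]
          simp: algebra_simps)
    ultimately show ?thesis by simp
  qed
  ultimately show ?thesis
    unfolding pfaffian_chain_def using assms by (intro conjI exI[of _ P]) auto
qed

section \<open>Separated systems\<close>

lemma separated_system_regular:
  fixes \<phi> :: "'n::finite \<Rightarrow> real \<Rightarrow> real" and y :: "real^'n"
  assumes "\<And>i. (\<phi> i has_real_derivative D i) (at (y $ i))"
  shows "(\<lambda>x. \<chi> i. \<phi> i (x $ i)) differentiable (at y)"
    and "det (jacobian (\<lambda>x. \<chi> i. \<phi> i (x $ i)) (at y)) = (\<Prod>i\<in>UNIV. D i)"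
proof -
  let ?F = "\<lambda>x::real^'n. \<chi> i. \<phi> i (x $ i)"
  have "((\<lambda>x::real^'n. \<phi> i (x $ i)) has_derivative (\<lambda>h. D i * h $ i)) (at y)" for i
  proof -
    have "((\<lambda>x::real^'n. x $ i) has_derivative (\<lambda>h. h $ i)) (at y)"
      by (rule bounded_linear_imp_has_derivative) (rule bounded_linear_vec_nth)
    then show ?thesis
      using has_derivative_compose assms[of i, unfolded has_field_derivative_def] by fast
  qed
  then have der: "(?F has_derivative (\<lambda>h. \<chi> i. D i * h $ i)) (at y)"
    by (subst has_derivative_componentwise_within) (auto simp: Basis_vec_def inner_axis)
  then show "?F differentiable (at y)" by (rule differentiableI)
  have "jacobian ?F (at y) = (\<chi> i j. D i * axis j 1 $ i)"
    unfolding jacobian_def frechet_derivative_at[OF der, symmetric] by (simp add: matrix_def)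
  then show "det (jacobian ?F (at y)) = (\<Prod>i\<in>UNIV. D i)"
    by (subst det_diagonal) (auto simp: axis_def)
qed

lemma finite_card_vec_box:
  fixes Z :: "'n::finite \<Rightarrow> 'a set"
  assumes "\<And>i. finite (Z i)"
  shows "finite {x :: 'a^'n. \<forall>i. x $ i \<in> Z i}"
    and "card {x :: 'a^'n. \<forall>i. x $ i \<in> Z i} = (\<Prod>i\<in>UNIV. card (Z i))"
proof -
  have bij: "bij_betw vec_nth {x :: 'a^'n. \<forall>i. x $ i \<in> Z i} (Pi\<^sub>E UNIV Z)"
    by (intro bij_betwI[of _ _ _ vec_lambda]) (auto simp: vec_eq_iff)
  have "finite (Pi\<^sub>E UNIV Z)" using assms by (intro finite_PiE) auto
  then show "finite {x :: 'a^'n. \<forall>i. x $ i \<in> Z i}"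
    using bij_betw_finite[OF bij] by blast
  show "card {x :: 'a^'n. \<forall>i. x $ i \<in> Z i} = (\<Prod>i\<in>UNIV. card (Z i))"
    using bij_betw_same_card[OF bij] by (simp add: card_PiE)
qed

theorem theorem1p3:
  fixes s :: nat
  assumes "s \<ge> 1"
  shows "\<exists>(q :: nat \<Rightarrow> real^'n \<Rightarrow> real) (c :: real).
           pfaffian_chain UNIV s s q \<and> c > 0 \<and>
           (\<forall>\<beta>\<ge>1. \<exists>f :: 'n \<Rightarrow> real^'n \<Rightarrow> real.
              (\<forall>i. pfaffian_function UNIV q s \<beta> s (f i)) \<and>
              (\<exists>Z. finite Z \<and> Z \<subseteq> regular_common_zeros f \<and>
                   real (card Z) \<ge> c * real \<beta> ^ (CARD('n) + s)))"
proof -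
  \<comment> \<open>The chain may depend on any one coordinate.\<close>
  define i0 :: 'n where "i0 = undefined"
  define q where "q k x = exp (log_prime k * x $ i0)" for k and x :: "real^'n"
  define r where "r i = (if i = i0 then s else 0)" for i
  \<comment> \<open>Coordinate \<open>i\<close> contributes at least \<open>h i * \<beta> ^ (r i + 1)\<close> simple zeros.\<close>
  define h where "h i = 1 / (2 * real (r i + 1) ^ (r i + 1))" for i
  define c where "c = (\<Prod>i\<in>UNIV. h i)"
  have chain: "pfaffian_chain UNIV s s q"
    unfolding q_def by (rule pfaffian_chain_exp_component[OF assms])
  have "c > 0" unfolding c_def h_def by (intro prod_pos) auto
  moreover have "\<exists>f :: 'n \<Rightarrow> real^'n \<Rightarrow> real. (\<forall>i. pfaffian_function UNIV q s \<beta> s (f i)) \<and>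
      (\<exists>Z. finite Z \<and> Z \<subseteq> regular_common_zeros f \<and>
        real (card Z) \<ge> c * real \<beta> ^ (CARD('n) + s))" if \<beta>: "\<beta> \<ge> 1" for \<beta>
  proof -
    define good where "good i P Z \<longleftrightarrow> P \<in> polys_le (curve_vars i (r i)) \<beta> \<and> finite Z \<and>
      real (card Z) \<ge> (real \<beta> / real (r i + 1)) ^ (r i + 1) / 2 \<and>
      (\<forall>z\<in>Z. mpoly_eval P (exp_curve z) = 0 \<and>
        (\<exists>D. D \<noteq> 0 \<and> ((\<lambda>t. mpoly_eval P (exp_curve t)) has_real_derivative D) (at z)))"
      for i P Z
    have "\<exists>P Z. good i P Z" for i
      unfolding good_def using exp_polynomial_with_many_simple_zeros[OF \<beta>, of i "r i"] by blast
    then obtain P Z where good: "\<And>i. good i (P i) (Z i)"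
      by metis
    have P: "P i \<in> polys_le (curve_vars i (r i)) \<beta>" and Z: "finite (Z i)"
        "real (card (Z i)) \<ge> (real \<beta> / real (r i + 1)) ^ (r i + 1) / 2" for i
      using good[of i] by (simp_all add: good_def)
    have zeros: "mpoly_eval (P i) (exp_curve z) = 0"
        "\<exists>D. D \<noteq> 0 \<and> ((\<lambda>t. mpoly_eval (P i) (exp_curve t)) has_real_derivative D) (at z)"
      if "z \<in> Z i" for i z
      using good[of i] that by (simp_all add: good_def)
    define \<phi> where "\<phi> i t = mpoly_eval (P i) (exp_curve t)" for i t
    define f where "f i x = \<phi> i (x $ i)" for i and x :: "real^'n"
    define B where "B = {x :: real^'n. \<forall>i. x $ i \<in> Z i}"
    have "pfaffian_function UNIV q s \<beta> s (f i)" for i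
    proof -
      have "f i x = mpoly_eval (P i) (XY_point q x)" for x
        unfolding f_def \<phi>_def
        by (rule mpoly_eval_cong[OF P])
           (auto simp: curve_vars_def exp_curve_def XY_point_def q_def r_def split: if_splits)
      moreover have "P i \<in> polys_le (XY_vars s) \<beta>"
        by (rule polys_le_mono[OF P])
           (auto simp: curve_vars_def XY_vars_def r_def split: if_splits)
      ultimately show ?thesis
        unfolding pfaffian_function_def using chain \<beta> by blast
    qed
    moreover have "B \<subseteq> regular_common_zeros f"
    proof
      fix y assume "y \<in> B"
      then have y: "y $ i \<in> Z i" for i by (simp add: B_def)
      obtain D where D: "\<And>i. D i \<noteq> 0" "\<And>i. (\<phi> i has_real_derivative D i) (at (y $ i))"
        using zeros(2)[OF y] unfolding \<phi>_def by metis
      show "y \<in> regular_common_zeros f"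
        using separated_system_regular[of \<phi> D y, OF D(2)] D(1) zeros(1)[OF y]
        by (simp add: regular_common_zeros_def f_def \<phi>_def[symmetric])
    qed
    moreover have "real (card B) \<ge> c * real \<beta> ^ (CARD('n) + s)"
    proof -
      have exponent: "CARD('n) + s = (\<Sum>i\<in>UNIV. r i + 1)"
        by (simp add: r_def sum.distrib del: One_nat_def)
      have "c * real \<beta> ^ (CARD('n) + s) = (\<Prod>i\<in>UNIV. h i * real \<beta> ^ (r i + 1))"
        by (simp only: c_def prod.distrib exponent power_sum)
      also have "\<dots> \<le> (\<Prod>i\<in>UNIV. real (card (Z i)))"
        using Z(2) by (intro prod_mono) (auto simp: h_def power_divide mult_ac)
      also have "\<dots> = real (card B)"
        unfolding B_def by (simp add: finite_card_vec_box(2)[OF Z(1)])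
      finally show ?thesis .
    qed
    moreover have "finite B"
      unfolding B_def by (rule finite_card_vec_box(1)[OF Z(1)])
    ultimately show ?thesis by blast
  qed
  ultimately show ?thesis using chain by blast
qed

end
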